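(* Assume there are constants $\gamma_t\ge 0$ ($t=0,\dots,T-1$) with $|C_t(x)-C_t(y)|\le\gamma_t|x-y|$ for all $x,y$. For every $t=0,1,\dots,T-2$ and every $x$ with $z_{k-1}<x\le z_k$, $z_k\in Z_\theta$: $\epsilon_t(x)\le\bar\epsilon_t(z_k)$.
   Context: Model. Fix an integer horizon $T\ge 2$, a discount factor $\alpha\in(0,1]$, and for $t=0,\dots,T-1$: unit ordering costs $c_t\in\mathbb R$, a salvage coefficient $c_T\in\mathbb R$, setup costs $K_t\ge 0$, functions $G_t:\mathbb R\to\mathbb R$, and independent nonnegative random demands $D_0,\dots,D_{T-1}$ with right-continuous distribution functions $F_t$ and finite means; all expectations appearing are assumed finite. Put $C_t(y)=(c_t-\alpha c_{t+1})y+G_t(y)+\alpha c_{t+1}E[D_t]$. Standing assumptions: (i) each $C_t$ is convex with $C_t(y)\to+\infty$ as $|y|\to\infty$; (ii) $K_t\ge \alpha K_{t+1}$ for $t=0,\dots,T-2$. Grid construction. Fix $\theta>0$, $z_m=m\theta$, $Z_\theta=\{z_m:m\in\mathbb Z\}$, $f_t(n)=F_t(z_{n+1})-F_t(z_n)$ ($n\ge -1$). $C^m_t=\min\{y: C_t(y)=\min_x C_t(x)\}$; with $z_{n_0}<C^m_t\le z_{n_0+1}$, $S^U_t=\min\{z_m\in Z_\theta: z_m\ge C^m_t,\ C_t(z_m)>C_t(z_{n_0})+K_t\}$. $s_{T-1}$ is a point with $s_{T-1}\le C^m_{T-1}$, $C_{T-1}(s_{T-1})=C_{T-1}(C^m_{T-1})+K_{T-1}$;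 $\bar I_{T-1}=s_{T-1}$. For $t=T-2,\dots,0$: $I_t=\max\{z_m\in Z_\theta: z_m<\min(\bar I_{t+1}-\theta,C^m_t)\}$, $\bar I_t=\max\{z_m\in Z_\theta: z_m\le I_t,\ C_t(z_m)>C_t(I_t)+K_t\}+\theta$. $H_{T-1}=C_{T-1}$, $S_{T-1}=C^m_{T-1}$; $V_t(y)=H_t(S_t)+K_t$ for $y<s_t$, $V_t(y)=H_t(y)$ for $y\ge s_t$. For $t=T-2,\dots,0$: $H_t(y)=C_t(y)+\alpha\sum_{n=-1}^\infty V_{t+1}(y-z_n)f_t(n)$; $S_t=\max\{z_m\in Z_\theta: I_t\le z_m\le S^U_t,\ H_t(z_m)=\min\{H_t(z_n):z_n\in Z_\theta, I_t\le z_n\le S^U_t\}\}$; $s_t=S_t$ if $K_t=0$, else $s_t=\min\{z_m\in Z_\theta:\bar I_t\le z_m\le S_t,\ H_t(z_m)\le H_t(S_t)+K_t\}$. Error terms. For $t=1,\dots,T-1$, $A_t(x)=E[V_t(x-D_{t-1})]-\sum_{n=-1}^{\infty}V_t(x-z_n)f_{t-1}(n)$. $\epsilon_{T-1}\equiv 0$; for $t=0,\dots,T-2$: $\epsilon_t(x)=\alpha A_{t+1}(S_t)+\alpha E[\epsilon_{t+1}(S_t-D_t)]$ if $x<s_t$, and $\epsilon_t(x)=\alpha A_{t+1}(x)+\alpha E[\epsilon_{t+1}(x-D_t)]$ if $x\ge s_t$. Upper estimate functions. $\bar\psi_{T-1}(x,y)=\gamma_{T-1}x$; $\bar\varphi_{T-1}(x,y)=0$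 if $y<s_{T-1}$ and $=\gamma_{T-1}x$ if $y\ge s_{T-1}$. For $t=0,\dots,T-2$, with $n$ the integer such that $z_{n-1}\le y-s_{t+1}<z_n$: $\bar\psi_t(x,y)=\gamma_tx$ if $y<s_{t+1}-\theta$, else $\bar\psi_t(x,y)=\gamma_tx+\alpha\sum_{m=-1}^{n-1}\bar\varphi_{t+1}(x,y-z_m)f_t(m)$; $\bar\varphi_t(x,y)=0$ if $y<s_t$, $=\bar\psi_t(y-s_t+\theta,y)$ if $y\ge s_t$ and $y-x<s_t$, $=\bar\psi_t(x,y)$ if $y\ge s_t$ and $y-x\ge s_t$. Bound $\bar\epsilon$. For $z_k\in Z_\theta$: $\bar\epsilon_{T-2}(z_k)=\alpha\gamma_{T-1}\theta$, and for $t=0,\dots,T-3$, $\bar\epsilon_t(z_k)=\alpha^{T-1-t}\gamma_{T-1}\theta+\sum_{i=0}^{T-3-t}2\alpha^i\big[\bar\psi_{t+i}(\theta,\max(\lambda_t(i),S_{t+i}))-\gamma_{t+i}\theta\big]$, where $\lambda_t(0)=z_k$ and $\lambda_t(i)=\max(\lambda_t(i-1),S_{t+i-1})+\theta$ for $i=1,\dots,T-3-t$. *)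

theory Defs
  imports "HOL-Probability.Probability"
begin

text \<open>Parameters of the finite-horizon inventory model with setupc costs.
  hor = T, disc = alpha, cst t = c_t (cst T is the salvage coefficient),
  setupc t = K_t, Gf t = G_t, dem t = distribution of D_t (a probability
  measure on the reals), th = theta, sfin = s_{T-1}, gam t = gamma_t.\<close>

record invm =
  hor :: nat
  disc :: real
  cst :: "nat \<Rightarrow> real"
  setupc :: "nat \<Rightarrow> real"
  Gf :: "nat \<Rightarrow> real \<Rightarrow> real"
  dem :: "nat \<Rightarrow> real measure"
  th :: real
  sfin :: real
  gam :: "nat \<Rightarrow> real"

definition Cf :: "invm \<Rightarrow> nat \<Rightarrow> real \<Rightarrow> real" where
  "Cf M t y = (cst M t - disc M * cst M (Suc t)) * y + Gf M t y
      + disc M * cst M (Suc t) * (\<integral>d. d \<partial>dem M t)"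

definition zg :: "invm \<Rightarrow> int \<Rightarrow> real" where
  "zg M m = real_of_int m * th M"

definition grid :: "invm \<Rightarrow> real set" where
  "grid M = range (zg M)"

definition Fd :: "invm \<Rightarrow> nat \<Rightarrow> real \<Rightarrow> real" where
  "Fd M t x = measure (dem M t) {..x}"

definition fd :: "invm \<Rightarrow> nat \<Rightarrow> int \<Rightarrow> real" where
  "fd M t n = Fd M t (zg M (n + 1)) - Fd M t (zg M n)"

definition Cm :: "invm \<Rightarrow> nat \<Rightarrow> real" where
  "Cm M t = (LEAST y. \<forall>x. Cf M t y \<le> Cf M t x)"

text \<open>S^U_t; z_{n_0} = theta * (ceiling(C^m_t/theta) - 1) satisfies z_{n_0} < C^m_t \<le> z_{n_0+1}.\<close>
definition SU :: "invm \<Rightarrow> nat \<Rightarrow> real" where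
  "SU M t = (LEAST z. z \<in> grid M \<and> Cm M t \<le> z \<and>
      Cf M t z > Cf M t (th M * (of_int \<lceil>Cm M t / th M\<rceil> - 1)) + setupc M t)"

text \<open>stage M k = (H_t, S_t, s_t, Ibar_t) for t = T-1-k.\<close>
primrec stage :: "invm \<Rightarrow> nat \<Rightarrow> (real \<Rightarrow> real) \<times> real \<times> real \<times> real" where
  "stage M 0 = (Cf M (hor M - 1), Cm M (hor M - 1), sfin M, sfin M)"
| "stage M (Suc k) = (case stage M k of (H', S', s', Ib') \<Rightarrow>
    let t = hor M - 2 - k;
        V' = (\<lambda>y. if y < s' then H' S' + setupc M (Suc t) else H' y);
        H = (\<lambda>y. Cf M t y + disc M * (\<Sum>n. V' (y - zg M (int n - 1)) * fd M t (int n - 1)));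
        I = (GREATEST z. z \<in> grid M \<and> z < min (Ib' - th M) (Cm M t));
        Ib = (GREATEST z. z \<in> grid M \<and> z \<le> I \<and> Cf M t z > Cf M t I + setupc M t) + th M;
        S = (GREATEST z. z \<in> grid M \<and> I \<le> z \<and> z \<le> SU M t \<and>
               (\<forall>w\<in>grid M. I \<le> w \<and> w \<le> SU M t \<longrightarrow> H z \<le> H w));
        s = (if setupc M t = 0 then S
             else (LEAST z. z \<in> grid M \<and> Ib \<le> z \<and> z \<le> S \<and> H z \<le> H S + setupc M t))
    in (H, S, s, Ib))"

definition Ht :: "invm \<Rightarrow> nat \<Rightarrow> real \<Rightarrow> real" where
  "Ht M t = fst (stage M (hor M - 1 - t))"
definition St :: "invm \<Rightarrow> nat \<Rightarrow> real" where
  "St M t = fst (snd (stage M (hor M - 1 - t)))"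
definition st :: "invm \<Rightarrow> nat \<Rightarrow> real" where
  "st M t = fst (snd (snd (stage M (hor M - 1 - t))))"
definition Ibar :: "invm \<Rightarrow> nat \<Rightarrow> real" where
  "Ibar M t = snd (snd (snd (stage M (hor M - 1 - t))))"

definition Vt :: "invm \<Rightarrow> nat \<Rightarrow> real \<Rightarrow> real" where
  "Vt M t y = (if y < st M t then Ht M t (St M t) + setupc M t else Ht M t y)"

definition At :: "invm \<Rightarrow> nat \<Rightarrow> real \<Rightarrow> real" where
  "At M t x = (\<integral>d. Vt M t (x - d) \<partial>dem M (t - 1))
     - (\<Sum>n. Vt M t (x - zg M (int n - 1)) * fd M (t - 1) (int n - 1))"

primrec epsk :: "invm \<Rightarrow> nat \<Rightarrow> real \<Rightarrow> real" where
  "epsk M 0 = (\<lambda>x. 0)"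
| "epsk M (Suc k) = (let t = hor M - 2 - k in
     (\<lambda>x. let y = (if x < st M t then St M t else x) in
        disc M * At M (Suc t) y + disc M * (\<integral>d. epsk M k (y - d) \<partial>dem M t)))"

definition eps :: "invm \<Rightarrow> nat \<Rightarrow> real \<Rightarrow> real" where
  "eps M t = epsk M (hor M - 1 - t)"

text \<open>psiphi M k = (psibar_t, phibar_t) for t = T-1-k.
  The integer n with z_{n-1} \<le> y - s_{t+1} < z_n satisfies n - 1 = floor((y - s_{t+1})/theta).\<close>
primrec psiphi :: "invm \<Rightarrow> nat \<Rightarrow> (real \<Rightarrow> real \<Rightarrow> real) \<times> (real \<Rightarrow> real \<Rightarrow> real)" where
  "psiphi M 0 = ((\<lambda>x y. gam M (hor M - 1) * x),
                 (\<lambda>x y. if y < st M (hor M - 1) then 0 else gam M (hor M - 1) * x))"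
| "psiphi M (Suc k) = (let t = hor M - 2 - k; phi' = snd (psiphi M k);
     psi = (\<lambda>x y. if y < st M (Suc t) - th M then gam M t * x
              else gam M t * x + disc M *
                (\<Sum>m\<in>{-1..\<lfloor>(y - st M (Suc t)) / th M\<rfloor>}. phi' x (y - zg M m) * fd M t m));
     phi = (\<lambda>x y. if y < st M t then 0
              else if y - x < st M t then psi (y - st M t + th M) y
              else psi x y)
   in (psi, phi))"

definition psib :: "invm \<Rightarrow> nat \<Rightarrow> real \<Rightarrow> real \<Rightarrow> real" where
  "psib M t = fst (psiphi M (hor M - 1 - t))"
definition phib :: "invm \<Rightarrow> nat \<Rightarrow> real \<Rightarrow> real \<Rightarrow> real" where
  "phib M t = snd (psiphi M (hor M - 1 - t))"

primrec lam :: "invm \<Rightarrow> nat \<Rightarrow> real \<Rightarrow> nat \<Rightarrow> real" where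
  "lam M t zk 0 = zk"
| "lam M t zk (Suc i) = max (lam M t zk i) (St M (t + i)) + th M"

definition epsbar :: "invm \<Rightarrow> nat \<Rightarrow> real \<Rightarrow> real" where
  "epsbar M t zk = (if t = hor M - 2 then disc M * gam M (hor M - 1) * th M
     else disc M ^ (hor M - 1 - t) * gam M (hor M - 1) * th M
       + (\<Sum>i\<in>{0..hor M - 3 - t}. 2 * disc M ^ i *
           (psib M (t + i) (th M) (max (lam M t zk i) (St M (t + i))) - gam M (t + i) * th M)))"

end

theory Submission
  imports Defs
begin

text \<open>
  Within one grid cell, the oscillation of \<open>Ht M t\<close> and of \<open>Vt M t\<close> is at most
  \<open>psib M t (th M)\<close> and \<open>phib M t (th M)\<close> evaluated at the right end of the cell; this follows by
  backward induction, where the jump of \<open>Vt M t\<close> at \<open>st M t\<close> is controlled by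
  \<open>Ht M t (st M t) \<le> Ht M t (St M t) + setupc M t \<le> Ht M t (st M t - th M)\<close>.
  Replacing a demand by the left end of its cell moves the inventory level across at most two adjacent
  cells.  On grid points \<open>phib M t (th M)\<close> is nondecreasing, so each error \<open>At M t\<close> costs at
  most twice the estimate at the larger cell: this is the factor 2 in \<open>epsbar\<close>.  In the last
  period the value function is globally Lipschitz, and no such factor is needed.
\<close>

text \<open>The partial unions increase to the whole union, so finite additivity passes to the
  limit. This later splits the expectation over a demand into its cells.\<close>

lemma set_integral_sums:
  fixes f :: "'a \<Rightarrow> real"
  assumes A: "\<And>n::nat. A n \<in> sets N" "disjoint_family A"
    and f: "set_integrable N (\<Union>n. A n) f"
  shows "(\<lambda>n. LINT x:A n|N. f x) sums (LINT x:(\<Union>n. A n)|N. f x)"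
proof -
  let ?B = "\<lambda>n. \<Union>i\<in>{..<n}. A i"
  have fA: "set_integrable N (A n) f" for n
    by (rule set_integrable_subset[OF f]) (use A in auto)
  have U: "(\<Union>n. ?B n) = (\<Union>n. A n)" by auto
  have "(\<lambda>n. LINT x:?B n|N. f x) \<longlonglongrightarrow> (LINT x:(\<Union>n. ?B n)|N. f x)"
    by (rule set_integral_cont_up) (use A f U in \<open>force simp: incseq_def\<close>)+
  moreover have "(LINT x:?B n|N. f x) = (\<Sum>i<n. LINT x:A i|N. f x)" for n
    by (rule set_integral_finite_Union)
      (use A fA in \<open>auto simp: disjoint_family_on_def\<close>)
  ultimately show ?thesis by (simp add: sums_def U)
qed

text \<open>The conditions on \<open>Vt\<close> and \<open>eps\<close> speak of period
  \<open>Suc t\<close> under the demand of period \<open>t\<close>, so that no truncated subtraction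
  occurs in the demand index.\<close>

locale inventory =
  fixes M :: invm
  assumes hor: "hor M \<ge> 2"
    and alpha: "0 < disc M"
    and theta: "0 < th M"
    and Kpos: "\<And>t. t < hor M \<Longrightarrow> 0 \<le> setupc M t"
    and prob: "\<And>t. t < hor M \<Longrightarrow> prob_space (dem M t)"
    and sets_dem: "\<And>t. t < hor M \<Longrightarrow> sets (dem M t) = sets borel"
    and dem_nonneg: "\<And>t. t < hor M \<Longrightarrow> AE d in dem M t. 0 \<le> d"
    and Cconv: "\<And>t. t < hor M \<Longrightarrow> convex_on UNIV (Cf M t)"
    and Ctop: "\<And>t. t < hor M \<Longrightarrow> filterlim (Cf M t) at_top at_top"
    and Cbot: "\<And>t. t < hor M \<Longrightarrow> filterlim (Cf M t) at_top at_bot"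
    and sfin: "Cf M (hor M - 1) (sfin M) = Cf M (hor M - 1) (Cm M (hor M - 1)) + setupc M (hor M - 1)"
    and V_integrable: "\<And>t y. t + 2 \<le> hor M \<Longrightarrow> integrable (dem M t) (\<lambda>d. Vt M (Suc t) (y - d))"
    and V_summable: "\<And>t y. t + 2 \<le> hor M \<Longrightarrow>
        summable (\<lambda>n. Vt M (Suc t) (y - zg M (int n - 1)) * fd M t (int n - 1))"
    and eps_integrable: "\<And>t y. t + 2 \<le> hor M \<Longrightarrow> integrable (dem M t) (\<lambda>d. eps M (Suc t) (y - d))"
    and gam_nonneg: "\<And>t. t < hor M \<Longrightarrow> 0 \<le> gam M t"
    and lip: "\<And>t u v. t < hor M \<Longrightarrow> \<bar>Cf M t u - Cf M t v\<bar> \<le> gam M t * \<bar>u - v\<bar>"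
begin

section \<open>Arithmetic of the grid and extrema over it\<close>

lemma zg_le_iff [simp]: "zg M i \<le> zg M j \<longleftrightarrow> i \<le> j"
  using theta by (simp add: zg_def)

lemma zg_less_iff [simp]: "zg M i < zg M j \<longleftrightarrow> i < j"
  using theta by (simp add: zg_def)

lemma zg_eq_iff [simp]: "zg M i = zg M j \<longleftrightarrow> i = j"
  using theta by (simp add: zg_def)

lemma zg_diff: "zg M i - zg M j = zg M (i - j)"
  by (simp add: zg_def left_diff_distrib)

lemma zg_Suc: "zg M (i + 1) = zg M i + th M"
  by (simp add: zg_def distrib_right)

lemma zg_pred: "zg M (i - 1) = zg M i - th M"
  by (simp add: zg_def left_diff_distrib)

lemma zg_floor: "zg M j \<le> y \<longleftrightarrow> j \<le> \<lfloor>y / th M\<rfloor>"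
  using theta by (simp add: zg_def le_floor_iff pos_le_divide_eq)

lemma zg_ceiling: "y \<le> zg M j \<longleftrightarrow> \<lceil>y / th M\<rceil> \<le> j"
  using theta by (simp add: zg_def ceiling_le_iff pos_divide_le_eq)

lemma cell_exists: obtains j where "zg M (j - 1) < y" "y \<le> zg M j"
proof
  show "y \<le> zg M \<lceil>y / th M\<rceil>" by (simp add: zg_ceiling)
  show "zg M (\<lceil>y / th M\<rceil> - 1) < y" using zg_ceiling[of y "\<lceil>y / th M\<rceil> - 1"] by linarith
qed

lemma grid_zg [simp]: "zg M j \<in> grid M"
  by (simp add: grid_def)

lemma gridE: assumes "z \<in> grid M" obtains j where "z = zg M j"
  using assms by (auto simp: grid_def)

text \<open>\<open>P\<close> may hold arbitrarily far to the left, so the search is cut off at the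
  index \<open>m0\<close> of a witness; only finitely many indices remain between it and the
  bound.\<close>

lemma grid_has_max:
  assumes "z0 \<in> grid M" "P z0" and b: "\<And>z. z \<in> grid M \<Longrightarrow> P z \<Longrightarrow> z \<le> b"
  obtains g where "g \<in> grid M" "P g" "\<And>z. z \<in> grid M \<Longrightarrow> P z \<Longrightarrow> z \<le> g"
proof -
  obtain m0 where m0: "P (zg M m0)" using assms(1,2) by (auto elim: gridE)
  define A where "A = {m. P (zg M m) \<and> m0 \<le> m}"
  have "A \<subseteq> {m0..\<lfloor>b / th M\<rfloor>}"
    using b by (auto simp: A_def zg_floor[symmetric])
  hence fin: "finite A" by (rule finite_subset) simp
  have "m0 \<in> A" using m0 by (simp add: A_def)
  hence "Max A \<in> A" using fin by (intro Max_in) auto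
  show ?thesis
  proof
    show "zg M (Max A) \<in> grid M" by simp
    show "P (zg M (Max A))" using \<open>Max A \<in> A\<close> by (simp add: A_def)
    fix z assume "z \<in> grid M" "P z"
    then obtain m where m: "z = zg M m" "P (zg M m)" by (auto elim: gridE)
    show "z \<le> zg M (Max A)"
    proof (cases "m0 \<le> m")
      case True
      with m have "m \<in> A" by (simp add: A_def)
      thus ?thesis using fin m by simp
    next
      case False
      moreover have "m0 \<le> Max A" using \<open>Max A \<in> A\<close> by (simp add: A_def)
      ultimately show ?thesis using m by simp
    qed
  qed
qed

lemma uminus_grid: "- z \<in> grid M \<longleftrightarrow> z \<in> grid M"
proof -
  have "- zg M j = zg M (- j)" for j by (simp add: zg_def)
  thus ?thesis by (metis gridE grid_zg add.inverse_inverse)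
qed

lemma grid_has_min:
  assumes "z0 \<in> grid M" "P z0" and b: "\<And>z. z \<in> grid M \<Longrightarrow> P z \<Longrightarrow> b \<le> z"
  obtains g where "g \<in> grid M" "P g" "\<And>z. z \<in> grid M \<Longrightarrow> P z \<Longrightarrow> g \<le> z"
proof -
  obtain g where g: "g \<in> grid M" "P (- g)" "\<And>z. z \<in> grid M \<Longrightarrow> P (- z) \<Longrightarrow> z \<le> g"
  proof (rule grid_has_max[of "- z0" "\<lambda>z. P (- z)" "- b"])
    fix z assume "z \<in> grid M" "P (- z)"
    thus "z \<le> - b" using b[of "- z"] by (simp add: uminus_grid)
  qed (use assms in \<open>auto simp: uminus_grid\<close>)
  show ?thesis
  proof (rule that[of "- g"])
    fix z assume "z \<in> grid M" "P z"
    thus "- g \<le> z" using g(3)[of "- z"] by (simp add: uminus_grid)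
  qed (use g in \<open>auto simp: uminus_grid\<close>)
qed

text \<open>\<open>GREATEST\<close> says something only where a maximum exists; a grid witness and
  an upper bound ensure this. The grid extrema in \<open>stage\<close> and \<open>SU\<close> become
  usable through this lemma and its mirror image.\<close>

lemma Greatest_grid:
  assumes "z0 \<in> grid M" "P z0" "\<And>z. z \<in> grid M \<Longrightarrow> P z \<Longrightarrow> z \<le> b"
  defines "g \<equiv> GREATEST z. z \<in> grid M \<and> P z"
  shows "g \<in> grid M" "P g" "\<And>z. z \<in> grid M \<Longrightarrow> P z \<Longrightarrow> z \<le> g"
proof -
  obtain h where h: "h \<in> grid M" "P h" "\<And>z. z \<in> grid M \<Longrightarrow> P z \<Longrightarrow> z \<le> h"
    using grid_has_max[of z0 P b] assms(1-3) by blast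
  have "g = h" unfolding g_def by (rule Greatest_equality) (use h in auto)
  thus "g \<in> grid M" "P g" "\<And>z. z \<in> grid M \<Longrightarrow> P z \<Longrightarrow> z \<le> g" using h by auto
qed

lemma Least_grid:
  assumes "z0 \<in> grid M" "P z0" "\<And>z. z \<in> grid M \<Longrightarrow> P z \<Longrightarrow> b \<le> z"
  defines "g \<equiv> LEAST z. z \<in> grid M \<and> P z"
  shows "g \<in> grid M" "P g" "\<And>z. z \<in> grid M \<Longrightarrow> P z \<Longrightarrow> g \<le> z"
proof -
  obtain h where h: "h \<in> grid M" "P h" "\<And>z. z \<in> grid M \<Longrightarrow> P z \<Longrightarrow> h \<le> z"
    using grid_has_min[of z0 P b] assms(1-3) by blast
  have "g = h" unfolding g_def by (rule Least_equality) (use h in auto)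
  thus "g \<in> grid M" "P g" "\<And>z. z \<in> grid M \<Longrightarrow> P z \<Longrightarrow> g \<le> z" using h by auto
qed

lemma grid_eventually_top:
  assumes "eventually P at_top" obtains z where "z \<in> grid M" "P z"
proof -
  obtain N where N: "\<And>y. N \<le> y \<Longrightarrow> P y" using assms by (auto simp: eventually_at_top_linorder)
  obtain j where "N \<le> zg M j" by (rule cell_exists)
  thus ?thesis using N that[of "zg M j"] by simp
qed

lemma grid_eventually_bot:
  assumes "eventually P at_bot" obtains z where "z \<in> grid M" "P z"
proof -
  obtain N where N: "\<And>y. y \<le> N \<Longrightarrow> P y" using assms by (auto simp: eventually_at_bot_linorder)
  obtain j where "zg M (j - 1) < N" by (rule cell_exists)
  thus ?thesis using N that[of "zg M (j - 1)"] by simp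
qed

section \<open>Minimiser and shape of the cost functions\<close>

lemma Cf_continuous: assumes "t < hor M" shows "continuous_on A (Cf M t)"
proof -
  have "(gam M t)-lipschitz_on A (Cf M t)"
    by (rule lipschitz_onI) (use lip gam_nonneg assms in \<open>auto simp: dist_real_def\<close>)
  thus ?thesis by (rule lipschitz_on_continuous_on)
qed

text \<open>\<open>Cm\<close> is a \<open>LEAST\<close> over the reals, so a smallest minimiser has
  to be exhibited. Coercivity confines the minimisers to a compact interval, where by continuity
  they form a nonempty compact set.\<close>

lemma Cm_min: assumes t: "t < hor M" shows "Cf M t (Cm M t) \<le> Cf M t x"
proof -
  let ?C = "Cf M t"
  obtain N1 where N1: "\<And>y. N1 \<le> y \<Longrightarrow> ?C 0 < ?C y"
    using filterlim_at_top_dense[THEN iffD1, OF Ctop[OF t]] by (auto simp: eventually_at_top_linorder)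
  obtain N2 where N2: "\<And>y. y \<le> N2 \<Longrightarrow> ?C 0 < ?C y"
    using filterlim_at_top_dense[THEN iffD1, OF Cbot[OF t]] by (auto simp: eventually_at_bot_linorder)
  \<comment> \<open>If 0 lay beyond one of the thresholds, \<open>?C 0 < ?C 0\<close> would
    follow.\<close>
  have le: "N2 < 0" "0 < N1" using N1[of 0] N2[of 0] by force+
  obtain m where m: "m \<in> {N2..N1}" "\<And>y. y \<in> {N2..N1} \<Longrightarrow> ?C m \<le> ?C y"
    using continuous_attains_inf[of "{N2..N1}" ?C] le Cf_continuous[OF t] by auto
  have glob: "?C m \<le> ?C y" for y
    using m(2)[of y] m(2)[of 0] N1[of y] N2[of y] le by (cases "y \<in> {N2..N1}") auto
  define A where "A = {y \<in> {N2..N1}. ?C y \<le> ?C m}"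
  have "closed A" unfolding A_def
    by (intro continuous_on_closed_Collect_le Cf_continuous[OF t] continuous_on_const) simp
  moreover have "bounded A" by (rule bounded_subset[of "{N2..N1}"]) (auto simp: A_def)
  ultimately have "compact A" by (simp add: compact_eq_bounded_closed)
  moreover have "m \<in> A" using m by (simp add: A_def)
  ultimately obtain a where a: "a \<in> A" "\<And>y. y \<in> A \<Longrightarrow> a \<le> y"
    using compact_attains_inf[of A] by auto
  have amin: "?C a \<le> ?C y" for y using a(1) glob[of y] by (simp add: A_def)
  have "Cm M t = a" unfolding Cm_def
  proof (rule Least_equality)
    show "\<forall>x. ?C a \<le> ?C x" using amin by simp
    fix y assume y: "\<forall>x. ?C y \<le> ?C x"
    have "?C y \<le> ?C 0" using y by simp
    hence "y \<in> {N2..N1}" using N1[of y] N2[of y] by force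
    hence "y \<in> A" using y by (simp add: A_def)
    thus "a \<le> y" by (rule a(2))
  qed
  thus ?thesis using amin by simp
qed

text \<open>By convexity the cost at a point between \<open>u\<close> and the minimiser is at most
  the larger end value, which is the one at \<open>u\<close>.\<close>

lemma Cf_antimono: 
  assumes t: "t < hor M" and "u \<le> v" "v < Cm M t" shows "Cf M t v \<le> Cf M t u"
proof -
  have "Cf M t v \<le> max (Cf M t u) (Cf M t (Cm M t))"
    by (rule convex_on_le_max) (use assms convex_on_subset[OF Cconv[OF t]] in auto)
  thus ?thesis using Cm_min[OF t, of u] by simp
qed

text \<open>Coercivity supplies a grid point that satisfies the condition in \<open>SU\<close>, so
  the \<open>LEAST\<close> exists and inherits the bound.\<close>

lemma Cm_le_SU: assumes t: "t < hor M" shows "Cm M t \<le> SU M t"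
proof -
  let ?c = "Cf M t (th M * (of_int \<lceil>Cm M t / th M\<rceil> - 1)) + setupc M t"
  have "eventually (\<lambda>z. ?c < Cf M t z \<and> Cm M t \<le> z) at_top"
    using filterlim_at_top_dense[THEN iffD1, OF Ctop[OF t]] eventually_ge_at_top
    by (intro eventually_conj) auto
  then obtain z0 where "z0 \<in> grid M" "?c < Cf M t z0 \<and> Cm M t \<le> z0"
    by (rule grid_eventually_top)
  thus ?thesis unfolding SU_def
    using Least_grid(2)[of z0 "\<lambda>z. Cm M t \<le> z \<and> ?c < Cf M t z" "Cm M t"] by auto
qed

section \<open>The recursion and its points \<open>I\<close>, \<open>Ibar\<close>,
  \<open>St\<close>, \<open>st\<close>\<close>

definition I :: "nat \<Rightarrow> real" where
  "I t = (GREATEST z. z \<in> grid M \<and> z < min (Ibar M (Suc t) - th M) (Cm M t))"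

lemma stage_unfold:
  assumes "t + 2 \<le> hor M"
  shows Ht_eq: "Ht M t y = Cf M t y + disc M * (\<Sum>n. Vt M (Suc t) (y - zg M (int n - 1)) * fd M t (int n - 1))"
    and Ibar_eq: "Ibar M t = (GREATEST z. z \<in> grid M \<and> z \<le> I t \<and> Cf M t z > Cf M t (I t) + setupc M t) + th M"
    and St_eq: "St M t = (GREATEST z. z \<in> grid M \<and> I t \<le> z \<and> z \<le> SU M t \<and>
               (\<forall>w\<in>grid M. I t \<le> w \<and> w \<le> SU M t \<longrightarrow> Ht M t z \<le> Ht M t w))"
    and st_eq: "st M t = (if setupc M t = 0 then St M t
             else (LEAST z. z \<in> grid M \<and> Ibar M t \<le> z \<and> z \<le> St M t \<and> Ht M t z \<le> Ht M t (St M t) + setupc M t))"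
proof -
  let ?k = "hor M - 1 - Suc t"
  \<comment> \<open>\<open>stage\<close> counts periods backwards from the last one, so the index of
    period \<open>t\<close> is the successor of that of period \<open>Suc t\<close>.\<close>
  have k: "hor M - 1 - t = Suc ?k" "hor M - 2 - ?k = t" using assms by auto
  obtain H' S' s' Ib' where st': "stage M ?k = (H', S', s', Ib')" by (metis prod_cases4)
  have e: "Ht M (Suc t) = H'" "St M (Suc t) = S'" "st M (Suc t) = s'" "Ibar M (Suc t) = Ib'"
    unfolding Ht_def St_def st_def Ibar_def st' by simp_all
  have V: "Vt M (Suc t) = (\<lambda>y. if y < s' then H' S' + setupc M (Suc t) else H' y)"
    by (auto simp: Vt_def e)
  show H: "Ht M t y = Cf M t y + disc M * (\<Sum>n. Vt M (Suc t) (y - zg M (int n - 1)) * fd M t (int n - 1))" for y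
    unfolding Ht_def k(1) stage.simps(2) st' prod.case Let_def k(2) fst_conv V ..
  have HF: "Ht M t = (\<lambda>y. Cf M t y + disc M * (\<Sum>n. Vt M (Suc t) (y - zg M (int n - 1)) * fd M t (int n - 1)))"
    using H by auto
  show IB: "Ibar M t = (GREATEST z. z \<in> grid M \<and> z \<le> I t \<and> Cf M t z > Cf M t (I t) + setupc M t) + th M"
    unfolding I_def e Ibar_def[of M t] k(1) stage.simps(2) st' prod.case Let_def k(2) fst_conv snd_conv ..
  show S: "St M t = (GREATEST z. z \<in> grid M \<and> I t \<le> z \<and> z \<le> SU M t \<and>
               (\<forall>w\<in>grid M. I t \<le> w \<and> w \<le> SU M t \<longrightarrow> Ht M t z \<le> Ht M t w))"
    unfolding HF I_def e V St_def[of M t] k(1) stage.simps(2) st' prod.case Let_def k(2) fst_conv snd_conv ..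
  show "st M t = (if setupc M t = 0 then St M t
             else (LEAST z. z \<in> grid M \<and> Ibar M t \<le> z \<and> z \<le> St M t \<and> Ht M t z \<le> Ht M t (St M t) + setupc M t))"
    unfolding S IB unfolding HF I_def e V st_def[of M t] k(1) stage.simps(2) st' prod.case Let_def k(2) fst_conv snd_conv ..
qed

lemma last_stage [simp]:
  "Ht M (hor M - Suc 0) = Cf M (hor M - Suc 0)" "St M (hor M - Suc 0) = Cm M (hor M - Suc 0)"
  "st M (hor M - Suc 0) = sfin M" "Ibar M (hor M - Suc 0) = sfin M"
  by (simp_all add: Ht_def St_def st_def Ibar_def)

lemma last_stage_cases: assumes "t < hor M" obtains "t = hor M - Suc 0" | "t + 2 \<le> hor M"
  using assms by linarith

lemma I_props:
  shows "I t \<in> grid M" "I t < Ibar M (Suc t) - th M" "I t < Cm M t"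
proof -
  let ?b = "min (Ibar M (Suc t) - th M) (Cm M t)"
  obtain j where "zg M (j - 1) < ?b" by (rule cell_exists)
  note Greatest_grid(1,2)[of "zg M (j - 1)" "\<lambda>z. z < ?b" ?b, OF grid_zg this, folded I_def]
  thus "I t \<in> grid M" "I t < Ibar M (Suc t) - th M" "I t < Cm M t" by auto
qed

lemma Ibar_props:
  assumes t: "t + 2 \<le> hor M"
  shows "Ibar M t \<in> grid M" "Ibar M t \<le> I t"
    "Cf M t (Ibar M t - th M) > Cf M t (I t) + setupc M t"
proof -
  have t': "t < hor M" using t by simp
  let ?P = "\<lambda>z. z \<le> I t \<and> Cf M t z > Cf M t (I t) + setupc M t"
  have "eventually ?P at_bot"
    using filterlim_at_top_dense[THEN iffD1, OF Cbot[OF t']] eventually_le_at_bot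
    by (intro eventually_conj) auto
  then obtain z0 where z0: "z0 \<in> grid M" "?P z0"
    by (rule grid_eventually_bot)
  define g where "g = (GREATEST z. z \<in> grid M \<and> ?P z)"
  have g: "g \<in> grid M" "?P g"
    using Greatest_grid(1,2)[of z0 ?P "I t", OF z0] unfolding g_def by auto
  have eq: "Ibar M t = g + th M" unfolding g_def using Ibar_eq[OF t] .
  obtain j where j: "g = zg M j" using g(1) by (rule gridE)
  obtain i where i: "I t = zg M i" using I_props(1) by (rule gridE)
  \<comment> \<open>As the setup cost is nonnegative, \<open>I t\<close> fails the strict
    inequality. So \<open>g\<close> lies at least one cell lower, and adding \<open>th M\<close>
    does not pass \<open>I t\<close>.\<close>
  have "g \<noteq> I t" using g(2) Kpos[OF t'] by auto
  with g j i have "j + 1 \<le> i" by auto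
  thus "Ibar M t \<le> I t" using eq j i zg_Suc by (metis zg_le_iff)
  show "Ibar M t \<in> grid M" using eq j zg_Suc[of j] grid_zg by metis
  show "Cf M t (Ibar M t - th M) > Cf M t (I t) + setupc M t" using g eq by simp
qed

text \<open>Only finitely many grid points lie between \<open>I t\<close> and \<open>SU M t\<close>,
  so the minimum is attained without continuity of \<open>Ht M t\<close>. The range is nonempty
  since \<open>I t\<close> is below \<open>Cm M t\<close>.\<close>

lemma St_props:
  assumes t: "t + 2 \<le> hor M"
  shows "St M t \<in> grid M" "I t \<le> St M t" "St M t \<le> SU M t"
    "\<And>w. w \<in> grid M \<Longrightarrow> I t \<le> w \<Longrightarrow> w \<le> SU M t \<Longrightarrow> Ht M t (St M t) \<le> Ht M t w"
proof -
  let ?G = "{z \<in> grid M. I t \<le> z \<and> z \<le> SU M t}"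
  let ?P = "\<lambda>z. I t \<le> z \<and> z \<le> SU M t \<and> (\<forall>w\<in>grid M. I t \<le> w \<and> w \<le> SU M t \<longrightarrow> Ht M t z \<le> Ht M t w)"
  have t': "t < hor M" using t by simp
  have "I t \<le> SU M t" using I_props(3)[of t] Cm_le_SU[OF t'] by simp
  hence ne: "?G \<noteq> {}" using I_props(1)[of t] by auto
  have "?G \<subseteq> zg M ` {\<lceil>I t / th M\<rceil>..\<lfloor>SU M t / th M\<rfloor>}"
    by (auto elim!: gridE simp: zg_floor zg_ceiling)
  hence fin: "finite ?G" by (rule finite_subset) simp
  define z0 where "z0 = arg_min_on (Ht M t) ?G"
  have "z0 \<in> ?G" "\<And>w. w \<in> ?G \<Longrightarrow> Ht M t z0 \<le> Ht M t w"
    unfolding z0_def using arg_min_if_finite(1)[OF fin ne] arg_min_least[OF fin ne] by auto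
  hence "z0 \<in> grid M" "?P z0" by auto
  note Greatest_grid(1,2)[of z0 ?P "SU M t", OF this, folded St_eq[OF t]]
  thus "St M t \<in> grid M" "I t \<le> St M t" "St M t \<le> SU M t"
    "\<And>w. w \<in> grid M \<Longrightarrow> I t \<le> w \<Longrightarrow> w \<le> SU M t \<Longrightarrow> Ht M t (St M t) \<le> Ht M t w" by auto
qed

text \<open>\<open>St M t\<close> is admissible because the setup cost is nonnegative, so the
  \<open>LEAST\<close> exists. The last claim is minimality; it leaves out zero setup cost, where
  \<open>st M t\<close> is set to \<open>St M t\<close> instead.\<close>

lemma st_props:
  assumes t: "t + 2 \<le> hor M"
  shows "st M t \<in> grid M" "Ibar M t \<le> st M t" "st M t \<le> St M t"
    "Ht M t (st M t) \<le> Ht M t (St M t) + setupc M t"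
    "\<And>z. z \<in> grid M \<Longrightarrow> Ibar M t \<le> z \<Longrightarrow> z < st M t \<Longrightarrow> setupc M t \<noteq> 0 \<Longrightarrow>
       Ht M t (St M t) + setupc M t < Ht M t z"
proof -
  have t': "t < hor M" using t by simp
  let ?P = "\<lambda>z. Ibar M t \<le> z \<and> z \<le> St M t \<and> Ht M t z \<le> Ht M t (St M t) + setupc M t"
  have S: "St M t \<in> grid M" "?P (St M t)"
    using St_props(1,2)[OF t] Ibar_props(2)[OF t] Kpos[OF t'] by auto
  note L = Least_grid[of "St M t" ?P "Ibar M t", OF S]
  have "st M t \<in> grid M \<and> ?P (st M t)"
    using L(1,2) S unfolding st_eq[OF t] by simp
  thus "st M t \<in> grid M" "Ibar M t \<le> st M t" and le: "st M t \<le> St M t"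
    and "Ht M t (st M t) \<le> Ht M t (St M t) + setupc M t" by auto
  fix z assume z: "z \<in> grid M" "Ibar M t \<le> z" "z < st M t" "setupc M t \<noteq> 0"
  have "\<not> ?P z" using L(3)[of z] z unfolding st_eq[OF t] by force
  thus "Ht M t (St M t) + setupc M t < Ht M t z" using z le by auto
qed

lemma Ibar_le_st: "t < hor M \<Longrightarrow> Ibar M t \<le> st M t"
  by (erule last_stage_cases) (simp_all add: st_props(2))

text \<open>Below \<open>I t\<close> every discretised demand leads to the region where \<open>Vt M (Suc t)\<close> is constant, so there
  \<open>Ht M t\<close> and \<open>Cf M t\<close> differ by a constant.\<close>

lemma Ht_diff_low:
  assumes t: "t + 2 \<le> hor M" and "u \<le> I t" "v \<le> I t"
  shows "Ht M t u - Ht M t v = Cf M t u - Cf M t v"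
proof -
  have s: "I t + th M < st M (Suc t)" using I_props(2)[of t] Ibar_le_st[of "Suc t"] t by simp
  have low: "y - zg M (int n - 1) < st M (Suc t)" if "y \<le> I t" for y n
  proof -
    \<comment> \<open>The first discretised demand is \<open>- th M\<close>, so a level can rise by
      \<open>th M\<close>. The margin in the definition of \<open>I t\<close> absorbs this.\<close>
    have "zg M (-1) \<le> zg M (int n - 1)" by simp
    hence "- th M \<le> zg M (int n - 1)" by (simp add: zg_def)
    thus ?thesis using s that by simp
  qed
  have "Vt M (Suc t) (u - zg M (int n - 1)) = Vt M (Suc t) (v - zg M (int n - 1))" for n
    using low[of u n] low[of v n] assms by (simp add: Vt_def)
  thus ?thesis by (simp add: Ht_eq[OF t])
qed

text \<open>This controls the jump of \<open>Vt M t\<close>. If the grid point before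
  \<open>st M t\<close> is still in the search range, optimality of \<open>St M t\<close> (zero
  setup cost) or minimality of \<open>st M t\<close> (positive setup cost) applies. Otherwise the
  comparison takes place at or below \<open>I t\<close>, where \<open>Cf M t\<close>
  decides.\<close>

lemma Ht_before_st:
  assumes t: "t + 2 \<le> hor M"
  shows "Ht M t (St M t) + setupc M t \<le> Ht M t (st M t - th M)"
proof -
  have t': "t < hor M" using t by simp
  have ISU: "I t \<le> SU M t" using I_props(3)[of t] Cm_le_SU[OF t'] by simp
  obtain s where s: "st M t = zg M s" using st_props(1)[OF t] by (rule gridE)
  have s1: "st M t - th M = zg M (s - 1)" by (simp add: s zg_pred)
  show ?thesis
  proof (cases "setupc M t = 0")
    case True
    have sS: "st M t = St M t" using True st_eq[OF t] by simp
    obtain i where i: "I t = zg M i" using I_props(1) by (rule gridE)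
    have "i \<le> s" using St_props(2)[OF t] s sS i by simp
    show ?thesis
    proof (cases "i = s")
      \<comment> \<open>Here \<open>St M t = I t\<close>, and to its left \<open>Ht M t\<close>
        varies like \<open>Cf M t\<close>, which is nonincreasing there.\<close>
      case True
      have "Ht M t (zg M (s - 1)) - Ht M t (zg M s) = Cf M t (zg M (s - 1)) - Cf M t (zg M s)"
        using True i by (intro Ht_diff_low[OF t]) auto
      moreover have "Cf M t (zg M s) \<le> Cf M t (zg M (s - 1))"
        using Cf_antimono[OF t', of "zg M (s - 1)" "zg M s"] I_props(3)[of t] i True by simp
      ultimately show ?thesis using \<open>setupc M t = 0\<close> sS s s1 by simp
    next
      case False
      hence "I t \<le> zg M (s - 1)" using \<open>i \<le> s\<close> i by simp
      moreover have "zg M (s - 1) \<le> SU M t" using St_props(3)[OF t] sS s1 theta by simp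
      ultimately show ?thesis using St_props(4)[OF t, of "zg M (s - 1)"] s1 \<open>setupc M t = 0\<close> by simp
    qed
  next
    case K: False
    obtain i where i: "Ibar M t = zg M i" using Ibar_props(1)[OF t] by (rule gridE)
    have "i \<le> s" using st_props(2)[OF t] s i by simp
    show ?thesis
    proof (cases "i = s")
      \<comment> \<open>Here \<open>st M t = Ibar M t\<close>. One step below, \<open>Cf M t\<close>
        exceeds its value at \<open>I t\<close> by more than the setup cost, and this excess carries
        over to \<open>Ht M t\<close>.\<close>
      case True
      have "Ht M t (zg M (s - 1)) - Ht M t (I t) = Cf M t (zg M (s - 1)) - Cf M t (I t)"
        using Ibar_props(2)[OF t] True i s s1 theta by (intro Ht_diff_low[OF t]) auto
      moreover have "Cf M t (I t) + setupc M t < Cf M t (zg M (s - 1))"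
        using Ibar_props(3)[OF t] True i s s1 by simp
      moreover have "Ht M t (St M t) \<le> Ht M t (I t)"
        using St_props(4)[OF t I_props(1) order_refl ISU] .
      ultimately show ?thesis using s1 by simp
    next
      case False
      hence "zg M (s - 1) < st M t" "Ibar M t \<le> zg M (s - 1)" using \<open>i \<le> s\<close> i s by auto
      thus ?thesis using st_props(5)[OF t, of "zg M (s - 1)"] K s1 by simp
    qed
  qed
qed

section \<open>Demand cells and the discretisation error\<close>

lemma fd_eq_measure:
  assumes t: "t < hor M" shows "fd M t n = measure (dem M t) {zg M n<..zg M (n + 1)}"
proof -
  interpret prob_space "dem M t" using prob[OF t] .
  have "{..zg M (n + 1)} - {..zg M n} = {zg M n<..zg M (n + 1)}" by auto
  thus ?thesis
    using finite_measure_Diff[of "{..zg M (n + 1)}" "{..zg M n}"]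
    by (simp add: fd_def Fd_def sets_dem[OF t])
qed

lemma fd_nonneg: "t < hor M \<Longrightarrow> 0 \<le> fd M t n"
  by (simp add: fd_eq_measure)

text \<open>Cells are open on the left, so zero demand belongs to the cell starting at
  \<open>zg M (-1)\<close>; this is why the indices start at -1.\<close>

lemma UN_cells: "(\<Union>n. {zg M (int n - 1)<..zg M (int n)}) = {- th M<..}"
proof (intro equalityI subsetI)
  fix d assume "d \<in> {- th M<..}"
  hence d: "zg M (-1) < d" by (simp add: zg_def)
  obtain j where j: "zg M (j - 1) < d" "d \<le> zg M j" by (rule cell_exists)
  have "zg M (-1) < zg M j" using d j(2) by linarith
  hence "0 \<le> j" by simp
  then obtain n where "j = int n" by (rule nonneg_int_cases)
  thus "d \<in> (\<Union>n. {zg M (int n - 1)<..zg M (int n)})" using j by auto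
next
  fix d assume "d \<in> (\<Union>n. {zg M (int n - 1)<..zg M (int n)})"
  then obtain n where "zg M (int n - 1) < d" by auto
  moreover have "zg M (-1) \<le> zg M (int n - 1)" by simp
  ultimately have "zg M (-1) < d" by linarith
  thus "d \<in> {- th M<..}" by (simp add: zg_def)
qed

lemma disjoint_cells: "disjoint_family (\<lambda>n. {zg M (int n - 1)<..zg M (int n)})"
  unfolding disjoint_family_on_def
proof (intro ballI impI)
  fix m n :: nat assume "m \<noteq> n"
  have False if "zg M (int m - 1) < d" "d \<le> zg M (int m)" "zg M (int n - 1) < d" "d \<le> zg M (int n)" for d
  proof -
    have "zg M (int m - 1) < zg M (int n)" "zg M (int n - 1) < zg M (int m)" using that by linarith+
    hence "int m = int n" unfolding zg_less_iff by linarith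
    thus False using \<open>m \<noteq> n\<close> by simp
  qed
  thus "{zg M (int m - 1)<..zg M (int m)} \<inter> {zg M (int n - 1)<..zg M (int n)} = {}"
    by (metis disjoint_iff greaterThanAtMost_iff)
qed

lemma fd_sums: assumes t: "t < hor M" shows "(\<lambda>n. fd M t (int n - 1)) sums 1"
proof -
  interpret prob_space "dem M t" using prob[OF t] .
  have "(\<lambda>n. measure (dem M t) {zg M (int n - 1)<..zg M (int n)}) sums measure (dem M t) {- th M<..}"
    using finite_measure_UNION[OF _ disjoint_cells]
    unfolding UN_cells by (simp add: sets_dem[OF t] image_subset_iff)
  moreover have "AE d in dem M t. d \<in> {- th M<..}"
    using dem_nonneg[OF t] by eventually_elim (use theta in auto)
  hence "measure (dem M t) {- th M<..} = 1"
    by (subst prob_eq_1) (auto simp: sets_dem[OF t])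
  ultimately show ?thesis by (simp add: fd_eq_measure[OF t])
qed

text \<open>The expectation is cut into demand cells. On each one the integrand exceeds its value at
  the left end by at most \<open>b n\<close>, and the probability of the cell is the weight
  \<open>fd\<close>.\<close>

lemma At_le:
  assumes t: "t + 2 \<le> hor M"
    and b: "\<And>n d. zg M (int n - 1) < d \<Longrightarrow> d \<le> zg M (int n) \<Longrightarrow>
        Vt M (Suc t) (y - d) - Vt M (Suc t) (y - zg M (int n - 1)) \<le> b n"
    and bs: "summable (\<lambda>n. b n * fd M t (int n - 1))"
  shows "At M (Suc t) y \<le> (\<Sum>n. b n * fd M t (int n - 1))"
proof -
  have t': "t < hor M" using t by simp
  interpret prob_space "dem M t" using prob[OF t'] .
  let ?A = "\<lambda>n. {zg M (int n - 1)<..zg M (int n)}"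
  let ?V = "\<lambda>d. Vt M (Suc t) (y - d)"
  have meas: "?A n \<in> sets (dem M t)" for n by (simp add: sets_dem[OF t'])
  have si: "set_integrable (dem M t) B ?V" if "B \<in> sets (dem M t)" for B
    unfolding set_integrable_def using V_integrable[OF t] that by (intro integrable_mult_indicator)
  have U: "(\<Union>n. ?A n) \<in> sets (dem M t)" using meas by auto
  have sums: "(\<lambda>n. LINT d:?A n|dem M t. ?V d) sums (LINT d:(\<Union>n. ?A n)|dem M t. ?V d)"
    by (rule set_integral_sums) (fact meas disjoint_cells si[OF U])+
  \<comment> \<open>Demands are almost surely nonnegative, so the cells miss only a null
    set.\<close>
  have "(\<integral>d. ?V d \<partial>dem M t) = (LINT d:(\<Union>n. ?A n)|dem M t. ?V d)"
    unfolding set_lebesgue_integral_def UN_cells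
  proof (rule integral_cong_AE)
    show "AE d in dem M t. ?V d = indicat_real {- th M<..} d *\<^sub>R ?V d"
      using dem_nonneg[OF t'] by eventually_elim (use theta in auto)
    show "?V \<in> borel_measurable (dem M t)" using V_integrable[OF t] by (rule borel_measurable_integrable)
    show "(\<lambda>d. indicat_real {- th M<..} d *\<^sub>R ?V d) \<in> borel_measurable (dem M t)"
      using si[OF U] unfolding set_integrable_def UN_cells by (rule borel_measurable_integrable)
  qed
  also have "\<dots> = (\<Sum>n. LINT d:?A n|dem M t. ?V d)"
    using sums by (rule sums_unique)
  also have "\<dots> \<le> (\<Sum>n. (?V (zg M (int n - 1)) + b n) * fd M t (int n - 1))"
  proof (rule suminf_le)
    fix n
    have "(LINT d:?A n|dem M t. ?V d) \<le> (LINT d:?A n|dem M t. ?V (zg M (int n - 1)) + b n)"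
    proof (rule set_integral_mono)
      show "set_integrable (dem M t) (?A n) (\<lambda>d. ?V (zg M (int n - 1)) + b n)"
        unfolding set_integrable_def by (intro integrable_mult_indicator meas integrable_const)
      fix d assume "d \<in> ?A n"
      thus "?V d \<le> ?V (zg M (int n - 1)) + b n" using b[of n d] by simp
    qed (rule si[OF meas])
    also have "\<dots> = (?V (zg M (int n - 1)) + b n) * fd M t (int n - 1)"
      using meas by (simp add: fd_eq_measure[OF t'] set_lebesgue_integral_def)
    finally show "(LINT d:?A n|dem M t. ?V d) \<le> (?V (zg M (int n - 1)) + b n) * fd M t (int n - 1)" .
  next
    show "summable (\<lambda>n. LINT d:?A n|dem M t. ?V d)" using sums by (rule sums_summable)
    show "summable (\<lambda>n. (?V (zg M (int n - 1)) + b n) * fd M t (int n - 1))"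
      using summable_add[OF V_summable[OF t, of y] bs] by (simp add: distrib_right)
  qed
  also have "\<dots> = (\<Sum>n. ?V (zg M (int n - 1)) * fd M t (int n - 1)) + (\<Sum>n. b n * fd M t (int n - 1))"
    using suminf_add[OF V_summable[OF t, of y] bs] by (simp add: distrib_right)
  finally show ?thesis by (simp add: At_def)
qed

section \<open>The upper estimate functions\<close>

lemma psib_eq:
  assumes t: "t + 2 \<le> hor M"
  shows "psib M t x y = gam M t * x + disc M *
    (\<Sum>m\<in>{-1..\<lfloor>(y - st M (Suc t)) / th M\<rfloor>}. phib M (Suc t) x (y - zg M m) * fd M t m)"
proof -
  let ?k = "hor M - 1 - Suc t"
  have k: "hor M - 1 - t = Suc ?k" "hor M - 2 - ?k = t" using t by auto
  have "psib M t x y = (if y < st M (Suc t) - th M then gam M t * x else gam M t * x + disc M *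
    (\<Sum>m\<in>{-1..\<lfloor>(y - st M (Suc t)) / th M\<rfloor>}. phib M (Suc t) x (y - zg M m) * fd M t m))"
    unfolding psib_def phib_def k(1) psiphi.simps Let_def k(2) by simp
  \<comment> \<open>In the first case of the definition the index range is empty, so one formula
    covers both cases.\<close>
  moreover have "\<lfloor>(y - st M (Suc t)) / th M\<rfloor> < -1" if "y < st M (Suc t) - th M"
    using that zg_floor[of "-1" "y - st M (Suc t)"] by (simp add: zg_def)
  ultimately show ?thesis by simp
qed

lemma psib_last: "psib M (hor M - Suc 0) x y = gam M (hor M - Suc 0) * x"
  by (simp add: psib_def)

text \<open>Before the last period, the middle case of \<open>phib\<close> occurs on the grid only
  at \<open>st M t\<close> itself, where its modified first argument equals \<open>th M\<close>
  again.\<close>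

lemma phib_theta:
  assumes "t < hor M"
  shows "phib M t (th M) (zg M j) = (if zg M j < st M t then 0 else psib M t (th M) (zg M j))"
  using assms
proof (cases rule: last_stage_cases)
  case 1
  thus ?thesis by (simp add: phib_def psib_def)
next
  case t: 2
  let ?k = "hor M - 1 - Suc t"
  have k: "hor M - 1 - t = Suc ?k" "hor M - 2 - ?k = t" using t by auto
  obtain s where s: "st M t = zg M s" using st_props(1)[OF t] by (rule gridE)
  have "phib M t (th M) (zg M j) = (if zg M j < st M t then 0
              else if zg M j - th M < st M t then psib M t (zg M j - st M t + th M) (zg M j)
              else psib M t (th M) (zg M j))"
    unfolding psib_def phib_def k(1) psiphi.simps Let_def k(2) by simp
  moreover have "j = s" if "\<not> zg M j < st M t" "zg M j - th M < st M t"
    using that s zg_pred[of j] zg_less_iff[of "j - 1" s] by simp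
  ultimately show ?thesis using s by auto
qed

text \<open>Terms beyond the finite range vanish because \<open>phib\<close> is zero below
  \<open>st\<close>. The series has the same weights as the one in \<open>Ht\<close>, which permits
  termwise comparison.\<close>

lemma psib_series:
  assumes t: "t + 2 \<le> hor M"
  shows "summable (\<lambda>n. phib M (Suc t) (th M) (zg M (j - (int n - 1))) * fd M t (int n - 1))"
    and "psib M t (th M) (zg M j) = gam M t * th M + disc M *
      (\<Sum>n. phib M (Suc t) (th M) (zg M (j - (int n - 1))) * fd M t (int n - 1))"
proof -
  have t': "Suc t < hor M" using t by simp
  let ?g = "\<lambda>m. phib M (Suc t) (th M) (zg M (j - m)) * fd M t m"
  let ?f = "\<lfloor>(zg M j - st M (Suc t)) / th M\<rfloor>"
  let ?N = "{..<nat (?f + 2)}"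
  have z: "?g (int n - 1) = 0" if "n \<notin> ?N" for n
  proof -
    have "\<not> int n - 1 \<le> ?f" using that by auto
    hence "\<not> zg M (int n - 1) \<le> zg M j - st M (Suc t)" by (simp add: zg_floor)
    hence "zg M (j - (int n - 1)) < st M (Suc t)" by (simp add: zg_diff[symmetric])
    thus ?thesis by (simp add: phib_theta[OF t'])
  qed
  have s: "(\<lambda>n. ?g (int n - 1)) sums (\<Sum>n\<in>?N. ?g (int n - 1))"
    by (rule sums_finite) (use z in auto)
  have "(\<Sum>n\<in>?N. ?g (int n - 1)) = (\<Sum>m\<in>{-1..?f}. ?g m)"
    by (rule sum.reindex_bij_witness[of _ "\<lambda>m. nat (m + 1)" "\<lambda>n. int n - 1"]) auto
  with s psib_eq[OF t] show "psib M t (th M) (zg M j) = gam M t * th M + disc M * (\<Sum>n. ?g (int n - 1))"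
    by (simp add: sums_unique[symmetric] zg_diff)
  show "summable (\<lambda>n. ?g (int n - 1))" using s by (rule sums_summable)
qed

text \<open>Backward induction on the series with nonnegative weights. Nonnegativity is carried
  along because \<open>phib\<close> switches from 0 to \<open>psib\<close> at \<open>st M t\<close>,
  and this switch must go upwards.\<close>

lemma phib_mono:
  assumes "t < hor M"
  shows "\<forall>i j. i \<le> j \<longrightarrow> 0 \<le> psib M t (th M) (zg M i) \<and> psib M t (th M) (zg M i) \<le> psib M t (th M) (zg M j)
     \<and> 0 \<le> phib M t (th M) (zg M i) \<and> phib M t (th M) (zg M i) \<le> phib M t (th M) (zg M j)"
proof -
  have "t \<le> hor M - 1" using assms by simp
  thus ?thesis
  proof (induction rule: inc_induct)
    case base
    have h: "hor M - 1 < hor M" using hor by simp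
    have g: "0 \<le> gam M (hor M - Suc 0) * th M" using gam_nonneg[of "hor M - Suc 0"] hor theta by simp
    show ?case
    proof (intro allI impI)
      fix i j :: int assume "i \<le> j"
      hence "zg M i \<le> zg M j" by simp
      thus "0 \<le> psib M (hor M - 1) (th M) (zg M i) \<and> psib M (hor M - 1) (th M) (zg M i) \<le> psib M (hor M - 1) (th M) (zg M j)
     \<and> 0 \<le> phib M (hor M - 1) (th M) (zg M i) \<and> phib M (hor M - 1) (th M) (zg M i) \<le> phib M (hor M - 1) (th M) (zg M j)"
        using g by (auto simp: phib_theta[OF h, simplified] psib_last simp del: zg_le_iff)
    qed
  next
    case (step u)
    hence u: "u + 2 \<le> hor M" "u < hor M" using assms by auto
    note IH = step.IH[rule_format]
    show ?case
    proof (intro allI impI)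
      fix i j :: int assume ij: "i \<le> j"
      let ?X = "\<lambda>j. (\<Sum>n. phib M (Suc u) (th M) (zg M (j - (int n - 1))) * fd M u (int n - 1))"
      have "?X i \<le> ?X j"
        using ij IH by (intro suminf_le psib_series(1)[OF u(1)] mult_right_mono fd_nonneg[OF u(2)]) auto
      moreover have "0 \<le> ?X i"
        using IH by (intro suminf_nonneg psib_series(1)[OF u(1)] mult_nonneg_nonneg fd_nonneg[OF u(2)]) auto
      ultimately have psi: "0 \<le> psib M u (th M) (zg M i)" "psib M u (th M) (zg M i) \<le> psib M u (th M) (zg M j)"
        using alpha gam_nonneg[OF u(2)] theta by (auto simp: psib_series(2)[OF u(1)])
      have "zg M i \<le> zg M j" using ij by simp
      thus "0 \<le> psib M u (th M) (zg M i) \<and> psib M u (th M) (zg M i) \<le> psib M u (th M) (zg M j)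
     \<and> 0 \<le> phib M u (th M) (zg M i) \<and> phib M u (th M) (zg M i) \<le> phib M u (th M) (zg M j)"
        using psi by (auto simp: phib_theta[OF u(2)] simp del: zg_le_iff)
    qed
  qed
qed

section \<open>Oscillation of the value functions within a cell\<close>

lemma Vt_last_lipschitz:
  "\<bar>Vt M (hor M - Suc 0) u - Vt M (hor M - Suc 0) v\<bar> \<le> gam M (hor M - Suc 0) * \<bar>u - v\<bar>"
proof -
  let ?T = "hor M - Suc 0"
  have h: "?T < hor M" using hor by simp
  \<comment> \<open>The equation for \<open>sfin M\<close> removes the jump: the value function is
    the cost composed with a 1-Lipschitz map.\<close>
  have V: "Vt M ?T y = Cf M ?T (max y (sfin M))" for y
    using sfin by (auto simp: Vt_def max_def)
  have "\<bar>Vt M ?T u - Vt M ?T v\<bar> \<le> gam M ?T * \<bar>max u (sfin M) - max v (sfin M)\<bar>"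
    unfolding V by (rule lip[OF h])
  also have "\<dots> \<le> gam M ?T * \<bar>u - v\<bar>"
    using gam_nonneg[OF h] by (intro mult_left_mono) auto
  finally show ?thesis .
qed

text \<open>Before the last period \<open>st M t\<close> is a grid point, so it is an end point of every cell that it
  meets and the jump of \<open>Vt M t\<close> there is never combined with an increment of \<open>Ht M t\<close>.
  In the last period \<open>st M t\<close> need not be a grid point, but there is no jump.\<close>

lemma Vt_cell:
  assumes "t < hor M"
  shows "\<forall>j. \<forall>v\<in>{zg M (j - 1)..zg M j}. \<forall>w\<in>{zg M (j - 1)..zg M j}.
     Vt M t v - Vt M t w \<le> phib M t (th M) (zg M j)"
proof -
  have "t \<le> hor M - 1" using assms by simp
  thus ?thesis
  proof (induction rule: inc_induct)
    case base
    have h: "hor M - 1 < hor M" using hor by simp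
    show ?case
    proof (intro allI ballI)
      fix j v w assume vw: "v \<in> {zg M (j - 1)..zg M j}" "w \<in> {zg M (j - 1)..zg M j}"
      show "Vt M (hor M - 1) v - Vt M (hor M - 1) w \<le> phib M (hor M - 1) (th M) (zg M j)"
      proof (cases "zg M j < sfin M")
        case True
        hence "v < sfin M" "w < sfin M" using vw by auto
        thus ?thesis using True by (simp add: phib_theta[OF h, simplified] Vt_def)
      next
        case False
        have "\<bar>v - w\<bar> \<le> th M" using vw by (auto simp: zg_pred)
        hence "gam M (hor M - Suc 0) * \<bar>v - w\<bar> \<le> gam M (hor M - Suc 0) * th M"
          using gam_nonneg h by (intro mult_left_mono) auto
        hence "Vt M (hor M - Suc 0) v - Vt M (hor M - Suc 0) w \<le> gam M (hor M - Suc 0) * th M"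
          using order_trans[OF abs_ge_self Vt_last_lipschitz[of v w]] by (rule order_trans[rotated])
        thus ?thesis using False
          by (simp add: phib_theta[OF h, simplified] psib_last)
      qed
    qed
  next
    case (step u)
    hence u: "u + 2 \<le> hor M" "u < hor M" using assms by auto
    note IH = step.IH[rule_format]
    have H: "Ht M u v - Ht M u w \<le> psib M u (th M) (zg M j)"
      if vw: "v \<in> {zg M (j - 1)..zg M j}" "w \<in> {zg M (j - 1)..zg M j}" for j v w
    proof -
      let ?S = "\<lambda>v n. Vt M (Suc u) (v - zg M (int n - 1)) * fd M u (int n - 1)"
      let ?b = "\<lambda>n. phib M (Suc u) (th M) (zg M (j - (int n - 1))) * fd M u (int n - 1)"
      have "suminf (?S v) - suminf (?S w) = (\<Sum>n. ?S v n - ?S w n)"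
        by (rule suminf_diff) (rule V_summable[OF u(1)])+
      also have "\<dots> \<le> (\<Sum>n. ?b n)"
      proof (rule suminf_le)
        fix n
        \<comment> \<open>Subtracting a grid point carries cells to cells, so the induction
          hypothesis applies to every term.\<close>
        have e: "zg M (j - (int n - 1)) = zg M j - zg M (int n - 1)"
          "zg M (j - (int n - 1) - 1) = zg M (j - 1) - zg M (int n - 1)"
          by (simp_all add: zg_def algebra_simps)
        have "Vt M (Suc u) (v - zg M (int n - 1)) - Vt M (Suc u) (w - zg M (int n - 1))
            \<le> phib M (Suc u) (th M) (zg M (j - (int n - 1)))"
          by (rule IH) (use vw e in auto)
        thus "?S v n - ?S w n \<le> ?b n"
          unfolding left_diff_distrib[symmetric] by (intro mult_right_mono fd_nonneg[OF u(2)])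
      qed (intro summable_diff V_summable[OF u(1)] psib_series(1)[OF u(1)])+
      finally have "disc M * (suminf (?S v) - suminf (?S w)) \<le> disc M * (\<Sum>n. ?b n)"
        using alpha by (intro mult_left_mono) auto
      moreover have "Cf M u v - Cf M u w \<le> gam M u * th M"
      proof -
        have "\<bar>v - w\<bar> \<le> th M" using vw by (auto simp: zg_pred)
        hence "gam M u * \<bar>v - w\<bar> \<le> gam M u * th M"
          using gam_nonneg[OF u(2)] by (intro mult_left_mono) auto
        thus ?thesis using lip[OF u(2), of v w] by simp
      qed
      ultimately show ?thesis
        by (simp add: Ht_eq[OF u(1)] psib_series(2)[OF u(1)] right_diff_distrib)
    qed
    obtain s where s: "st M u = zg M s" using st_props(1)[OF u(1)] by (rule gridE)
    show ?case
    proof (intro allI ballI)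
      fix j v w assume vw: "v \<in> {zg M (j - 1)..zg M j}" "w \<in> {zg M (j - 1)..zg M j}"
      consider "j < s" | "j = s" | "s \<le> j - 1" by linarith
      thus "Vt M u v - Vt M u w \<le> phib M u (th M) (zg M j)"
      proof cases
        case 1
        hence "zg M j < zg M s" by simp
        hence "v < st M u" "w < st M u" "zg M j < st M u" using vw s by (auto simp del: zg_less_iff)
        thus ?thesis by (simp add: phib_theta[OF u(2)] Vt_def)
      next
        case 2
        \<comment> \<open>In the cell ending at \<open>st M u\<close>, \<open>Vt M u\<close> equals
          \<open>?c\<close> except at the right end, where it drops to
          \<open>Ht M u (zg M s)\<close>. The drop is at most the change of \<open>Ht M u\<close>
          between the two ends of the cell.\<close>
        let ?c = "Ht M u (St M u) + setupc M u"
        have V: "Vt M u y = (if y = zg M s then Ht M u (zg M s) else ?c)" if "y \<in> {zg M (j - 1)..zg M j}" for y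
          using that 2 s by (auto simp: Vt_def)
        have "Ht M u (zg M s) \<le> ?c" using st_props(4)[OF u(1)] s by simp
        moreover have "?c \<le> Ht M u (zg M (s - 1))" using Ht_before_st[OF u(1)] s by (simp add: zg_pred)
        moreover have "Ht M u (zg M (s - 1)) - Ht M u (zg M s) \<le> psib M u (th M) (zg M s)"
          by (rule H) auto
        ultimately show ?thesis using V[OF vw(1)] V[OF vw(2)] 2 s
          by (auto simp: phib_theta[OF u(2)])
      next
        case 3
        hence "zg M s \<le> zg M (j - 1)" by simp
        hence "\<not> v < st M u" "\<not> w < st M u" "\<not> zg M j < st M u"
          using vw s by (auto simp del: zg_le_iff zg_less_iff)
        thus ?thesis using H[OF vw] by (simp add: phib_theta[OF u(2)] Vt_def)
      qed
    qed
  qed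
qed

section \<open>Errors of a single period\<close>

lemma At_le_psib:
  assumes t: "t + 2 \<le> hor M" and y: "y \<le> zg M j"
  shows "disc M * At M (Suc t) y \<le> 2 * (psib M t (th M) (zg M j) - gam M t * th M)"
proof -
  have t': "t < hor M" "Suc t < hor M" using t by auto
  \<comment> \<open>The bound is derived in the cell that really contains \<open>y\<close> and
    enlarged to cell \<open>j\<close> at the end by monotonicity.\<close>
  obtain i where i: "zg M (i - 1) < y" "y \<le> zg M i" by (rule cell_exists)
  have "zg M (i - 1) < zg M j" using i(1) y by linarith
  hence ij: "i \<le> j" by simp
  note cell = Vt_cell[OF t'(2), rule_format]
  note mono = phib_mono[OF t'(2), rule_format]
  let ?b = "\<lambda>n. 2 * phib M (Suc t) (th M) (zg M (i - (int n - 1)))"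
  have sum: "summable (\<lambda>n. ?b n * fd M t (int n - 1))"
    using summable_mult[OF psib_series(1)[OF t, of i], of 2] by (simp add: mult.assoc)
  have "At M (Suc t) y \<le> (\<Sum>n. ?b n * fd M t (int n - 1))"
  proof (rule At_le[OF t _ sum])
    fix n d assume d: "zg M (int n - 1) < d" "d \<le> zg M (int n)"
    let ?V = "Vt M (Suc t)" and ?l = "i - (int n - 1)"
    have e: "zg M ?l = zg M i - zg M (int n - 1)"
      "zg M (?l - 1) = zg M (i - 1) - zg M (int n - 1)" "zg M (?l - 1) = zg M i - zg M (int n)"
      "zg M (?l - 1 - 1) = zg M (i - 1) - zg M (int n)"
      by (simp_all add: zg_def algebra_simps)
    have w: "y - zg M (int n - 1) \<in> {zg M (?l - 1)..zg M ?l}" using i e by auto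
    show "?V (y - d) - ?V (y - zg M (int n - 1)) \<le> ?b n"
    proof (cases "zg M (?l - 1) \<le> y - d")
      case True
      have "?V (y - d) - ?V (y - zg M (int n - 1)) \<le> phib M (Suc t) (th M) (zg M ?l)"
        by (rule cell) (use w True d in auto)
      thus ?thesis using mono[of ?l ?l] by simp
    next
      case False
      \<comment> \<open>The two levels lie in adjacent cells; the path between them is split at the
        common end point \<open>zg M (?l - 1)\<close>.\<close>
      have "?V (y - d) - ?V (zg M (?l - 1)) \<le> phib M (Suc t) (th M) (zg M (?l - 1))"
        by (rule cell) (use False i d e in auto)
      moreover have "?V (zg M (?l - 1)) - ?V (y - zg M (int n - 1)) \<le> phib M (Suc t) (th M) (zg M ?l)"
        by (rule cell) (use w in auto)
      moreover have "phib M (Suc t) (th M) (zg M (?l - 1)) \<le> phib M (Suc t) (th M) (zg M ?l)"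
        using mono[of "?l - 1" ?l] by simp
      ultimately show ?thesis by simp
    qed
  qed
  also have "\<dots> = 2 * (\<Sum>n. phib M (Suc t) (th M) (zg M (i - (int n - 1))) * fd M t (int n - 1))"
    using suminf_mult[OF psib_series(1)[OF t, of i], of 2] by (simp add: mult.assoc)
  finally have "disc M * At M (Suc t) y \<le> 2 * (psib M t (th M) (zg M i) - gam M t * th M)"
    using alpha by (simp add: psib_series(2)[OF t] mult_left_mono)
  also have "\<dots> \<le> 2 * (psib M t (th M) (zg M j) - gam M t * th M)"
    using phib_mono[OF t'(1), rule_format, OF ij] by simp
  finally show ?thesis .
qed

text \<open>The global Lipschitz bound covers a displacement of at most \<open>th M\<close> even
  across a cell boundary, and the cell weights sum to 1.\<close>

lemma At_last_le: "At M (hor M - 1) y \<le> gam M (hor M - 1) * th M"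
proof -
  let ?T = "hor M - Suc 0"
  define t where "t = hor M - 2"
  have t: "?T = Suc t" "t + 2 \<le> hor M" "t < hor M" using hor by (auto simp: t_def)
  let ?b = "\<lambda>n::nat. gam M ?T * th M"
  have sum: "(\<lambda>n. ?b n * fd M t (int n - 1)) sums (gam M ?T * th M * 1)"
    by (intro sums_mult fd_sums[OF t(3)])
  have "At M (Suc t) y \<le> (\<Sum>n. ?b n * fd M t (int n - 1))"
  proof (rule At_le[OF t(2) _ sums_summable[OF sum]])
    fix n d assume d: "zg M (int n - 1) < d" "d \<le> zg M (int n)"
    have "gam M ?T * \<bar>(y - d) - (y - zg M (int n - 1))\<bar> \<le> gam M ?T * th M"
      using d gam_nonneg[of ?T] hor by (intro mult_left_mono) (auto simp: zg_pred)
    thus "Vt M (Suc t) (y - d) - Vt M (Suc t) (y - zg M (int n - 1)) \<le> ?b n"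
      using Vt_last_lipschitz[of "y - d" "y - zg M (int n - 1)"] t(1) by simp
  qed
  thus ?thesis using sums_unique[OF sum] t(1) by simp
qed

section \<open>Accumulation of the errors over the periods\<close>

lemma eps_eq:
  assumes t: "t + 2 \<le> hor M"
  defines "y \<equiv> \<lambda>x. if x < st M t then St M t else x"
  shows "eps M t x = disc M * At M (Suc t) (y x) + disc M * (\<integral>d. eps M (Suc t) (y x - d) \<partial>dem M t)"
proof -
  let ?k = "hor M - 1 - Suc t"
  have k: "hor M - 1 - t = Suc ?k" "hor M - 2 - ?k = t" using t by auto
  show ?thesis unfolding eps_def k(1) epsk.simps Let_def k(2) y_def ..
qed

text \<open>\<open>lam\<close> grows at its far end; peeling off the first step instead restarts it
  in the next period, as a recursion for \<open>epsbar\<close> requires.\<close>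

lemma lam_shift: "lam M t z (Suc i) = lam M (Suc t) (max z (St M t) + th M) i"
  by (induction i) auto

lemma epsbar_step:
  assumes "t + 3 \<le> hor M"
  shows "epsbar M t z = 2 * (psib M t (th M) (max z (St M t)) - gam M t * th M)
    + disc M * epsbar M (Suc t) (max z (St M t) + th M)"
proof -
  let ?z = "max z (St M t) + th M"
  let ?f = "\<lambda>t z i. 2 * disc M ^ i * (psib M (t + i) (th M) (max (lam M t z i) (St M (t + i))) - gam M (t + i) * th M)"
  have f: "?f t z (Suc i) = disc M * ?f (Suc t) ?z i" for i
    by (simp add: lam_shift del: lam.simps)
  \<comment> \<open>With \<open>lessThan\<close> the sum is empty for \<open>t = hor M - 2\<close>,
    so both branches of \<open>epsbar\<close> agree in form; \<open>{0..hor M - 3 - t}\<close> would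
    be \<open>{0..0}\<close> there.\<close>
  have eb: "epsbar M t z = disc M ^ (hor M - 1 - t) * gam M (hor M - 1) * th M + sum (?f t z) {..<hor M - 2 - t}"
    if "t + 2 \<le> hor M" for t z
  proof (cases "t + 2 = hor M")
    case True
    hence "t = hor M - 2" "hor M - 2 - t = 0" "hor M - 1 - t = 1" by auto
    thus ?thesis by (simp add: epsbar_def)
  next
    case False
    hence "{0..hor M - 3 - t} = {..<hor M - 2 - t}" "t \<noteq> hor M - 2" using that by auto
    thus ?thesis by (simp add: epsbar_def)
  qed
  have n: "hor M - 2 - t = Suc (hor M - 2 - Suc t)" "hor M - 1 - t = Suc (hor M - 1 - Suc t)"
    using assms by auto
  have "epsbar M t z = disc M * disc M ^ (hor M - 1 - Suc t) * gam M (hor M - 1) * th M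
      + (?f t z 0 + (\<Sum>i<hor M - 2 - Suc t. ?f t z (Suc i)))"
    using eb[of t z] assms unfolding n sum.lessThan_Suc_shift by simp
  also have "\<dots> = ?f t z 0 + disc M * epsbar M (Suc t) ?z"
    unfolding f sum_distrib_left[symmetric] using eb[of "Suc t" ?z] assms by (simp add: algebra_simps)
  finally show ?thesis by simp
qed

text \<open>The claim concerns every \<open>x\<close> up to \<open>zg M k\<close>, not just one
  cell, because demand can move the level arbitrarily far down.\<close>

lemma eps_le_epsbar:
  assumes t: "t + 2 \<le> hor M"
  shows "\<forall>x k. x \<le> zg M k \<longrightarrow> eps M t x \<le> epsbar M t (zg M k)"
proof -
  have "t \<le> hor M - 2" using t by simp
  thus ?thesis
  proof (induction rule: inc_induct)
    case base
    have h: "hor M - 2 + 2 \<le> hor M" "Suc (hor M - 2) = hor M - 1" using hor by auto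
    have "eps M (hor M - 1) = (\<lambda>x. 0)" by (simp add: eps_def)
    hence "eps M (hor M - 2) x \<le> disc M * (gam M (hor M - 1) * th M)" for x
      unfolding eps_eq[OF h(1)] h(2) using mult_left_mono[OF At_last_le, of "disc M"] alpha by simp
    moreover have "epsbar M (hor M - 2) z = disc M * (gam M (hor M - 1) * th M)" for z
      by (simp add: epsbar_def)
    ultimately show ?case by simp
  next
    case (step u)
    hence u: "u + 2 \<le> hor M" "u < hor M" "u + 3 \<le> hor M" using assms by auto
    interpret prob_space "dem M u" using prob[OF u(2)] .
    show ?case
    proof (intro allI impI)
      fix x k assume x: "x \<le> zg M k"
      define y where "y = (if x < st M u then St M u else x)"
      define Y where "Y = max (zg M k) (St M u)"
      have "Y \<in> grid M" using St_props(1)[OF u(1)] by (simp add: Y_def max_def)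
      then obtain j where j: "Y = zg M j" by (rule gridE)
      have "y \<le> Y" using x by (auto simp: y_def Y_def)
      \<comment> \<open>\<open>lam\<close> adds \<open>th M\<close> in each period, so the induction
        hypothesis is taken at the grid point following \<open>Y\<close>; nonnegative demand keeps
        \<open>y - d\<close> below it.\<close>
      have "AE d in dem M u. eps M (Suc u) (y - d) \<le> epsbar M (Suc u) (zg M (j + 1))"
        using dem_nonneg[OF u(2)]
      proof eventually_elim
        case (elim d)
        hence "y - d \<le> zg M (j + 1)" using \<open>y \<le> Y\<close> j theta by (simp add: zg_Suc)
        thus ?case using step.IH by simp
      qed
      hence "(\<integral>d. eps M (Suc u) (y - d) \<partial>dem M u) \<le> (\<integral>d. epsbar M (Suc u) (zg M (j + 1)) \<partial>dem M u)"
        by (intro integral_mono_AE eps_integrable[OF u(1)]) auto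
      hence "disc M * (\<integral>d. eps M (Suc u) (y - d) \<partial>dem M u) \<le> disc M * epsbar M (Suc u) (Y + th M)"
        using alpha by (simp add: prob_space zg_Suc j)
      moreover have "disc M * At M (Suc u) y \<le> 2 * (psib M u (th M) Y - gam M u * th M)"
        using At_le_psib[OF u(1)] \<open>y \<le> Y\<close> j by simp
      ultimately show "eps M u x \<le> epsbar M u (zg M k)"
        using eps_eq[OF u(1), of x] epsbar_step[OF u(3), of "zg M k"] by (simp add: y_def Y_def)
    qed
  qed
qed

end

theorem theorem4p4:
  fixes M :: invm and t :: nat and k :: int and x :: real
  assumes hor: "hor M \<ge> 2"
    and alpha: "0 < disc M" "disc M \<le> 1"
    and theta: "0 < th M"
    and Kpos: "\<forall>t<hor M. 0 \<le> setupc M t"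
    and Kdec: "\<forall>t. t + 2 \<le> hor M \<longrightarrow> disc M * setupc M (Suc t) \<le> setupc M t"
    and demand: "\<forall>t<hor M. prob_space (dem M t) \<and> sets (dem M t) = sets borel
                   \<and> (AE d in dem M t. 0 \<le> d) \<and> integrable (dem M t) (\<lambda>d. d)"
    and Cconv: "\<forall>t<hor M. convex_on UNIV (Cf M t)
                   \<and> filterlim (Cf M t) at_top at_top \<and> filterlim (Cf M t) at_top at_bot"
    and sT: "sfin M \<le> Cm M (hor M - 1)"
            "Cf M (hor M - 1) (sfin M) = Cf M (hor M - 1) (Cm M (hor M - 1)) + setupc M (hor M - 1)"
    and finV: "\<forall>t. 1 \<le> t \<and> t < hor M \<longrightarrow> (\<forall>y.
                 integrable (dem M (t - 1)) (\<lambda>d. Vt M t (y - d))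
               \<and> summable (\<lambda>n. Vt M t (y - zg M (int n - 1)) * fd M (t - 1) (int n - 1)))"
    and fineps: "\<forall>t. t + 2 \<le> hor M \<longrightarrow> (\<forall>y. integrable (dem M t) (\<lambda>d. eps M (Suc t) (y - d)))"
    and lip: "\<forall>t<hor M. 0 \<le> gam M t \<and> (\<forall>u v. \<bar>Cf M t u - Cf M t v\<bar> \<le> gam M t * \<bar>u - v\<bar>)"
    and tT: "t + 2 \<le> hor M"
    and xk: "zg M (k - 1) < x" "x \<le> zg M k"
  shows "eps M t x \<le> epsbar M t (zg M k)"
proof -
  interpret inventory M
  proof (rule inventory.intro)
    fix t y assume t: "t + 2 \<le> hor M"
    hence "1 \<le> Suc t \<and> Suc t < hor M" by simp
    from finV[rule_format, OF this, of y]
    show "integrable (dem M t) (\<lambda>d. Vt M (Suc t) (y - d))"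
      "summable (\<lambda>n. Vt M (Suc t) (y - zg M (int n - 1)) * fd M t (int n - 1))"
      unfolding diff_Suc_1 by blast+
  qed (simp_all add: hor alpha theta Kpos demand Cconv sT(2)[simplified] fineps lip)
  show ?thesis using eps_le_epsbar[OF tT] xk(2) by blast
qed

end
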